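(* Let $(G,c)$ be an edge-colored spatial graph. The collection of colored links $T_{\mathrm{col}}(G)$, taken up to ambient isotopy, is a topological invariant of $(G,c)$. That is, if two edge-colored spatial graphs are related by an ambient isotopy preserving the edge colors, then their collections $T_{\mathrm{col}}$ coincide as sets of ambient isotopy classes of colored links.
   Context: A spatial graph is an embedding of a (finite) graph $G$ in $S^3$. An edge-colored spatial graph $(G,c)$ is a spatial graph $G$ equipped with a coloring function $c:E(G)\to C$ for a set of colors $C$. Local replacement: at a vertex $v$ of degree $d$, a local replacement consists of choosing one of the $\frac{d(d-1)}{2}$ unordered pairs of edge-ends at $v$, connecting these two edge-ends to each other by a small arc through $v$, and leaving all other edge-ends at $v$ as free ends (at a vertex of degree less than $2$ there is nothing to connect, and any edge-end there is a free end). In the colored local replacement the new arc is colored by the subset of $C$ consisting of the colors of the edges that are joined. The collection $T_{\mathrm{col}}(G)$: for each choice of a local replacement at every vertex of $G$, one obtains a disjoint union of closed curves and arcs in $S^3$; remove all non-closed curves. What remains is a link in $S^3$, each of whose components is colored by the subset $\gamma\subseteq C$ consisting of the colors of all edges of $G$ contained in that component. $T_{\mathrm{col}}(G)$ is the set of all colored links (with colors in the power set $\mathcal{P}(C)$) obtained in this way, and colored links are considered up to ambient isotopy of $S^3$ preserving the colors of components. *)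

theory Defs
  imports "HOL-Analysis.Analysis" "Graph_Theory.Digraph"
begin

abbreviation S3 :: "(real ^ 4) set" where
  "S3 \<equiv> sphere 0 1"

section \<open>Edge-colored spatial graphs\<close>

text \<open>
  The finite graph is an undirected multigraph, loops and parallel edges included.  The
  direction that a \<^typ>\<open>('v, 'e) pre_digraph\<close> gives to an edge \<open>e\<close> only says in which
  direction the embedded edge \<open>\<gamma> e\<close> is parametrized.  The axioms are those of an injective
  continuous map into the 3-sphere from the geometric realization of the (finite) graph; since
  the realization is compact, this is the same as an embedding.
\<close>

locale spatial_graph = fin_digraph G
  for G :: "('v, 'e) pre_digraph" +
  fixes p :: "'v \<Rightarrow> real ^ 4" and \<gamma> :: "'e \<Rightarrow> real \<Rightarrow> real ^ 4"
  assumes vertex_inj: "inj_on p (verts G)"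
    and vertex_in: "p ` verts G \<subseteq> S3"
    and edge_simple: "e \<in> arcs G \<Longrightarrow> simple_path (\<gamma> e)"
    and edge_in: "e \<in> arcs G \<Longrightarrow> path_image (\<gamma> e) \<subseteq> S3"
    and edge_start: "e \<in> arcs G \<Longrightarrow> pathstart (\<gamma> e) = p (tail G e)"
    and edge_finish: "e \<in> arcs G \<Longrightarrow> pathfinish (\<gamma> e) = p (head G e)"
    and edge_vertices:
      "e \<in> arcs G \<Longrightarrow> path_image (\<gamma> e) \<inter> p ` verts G = {p (tail G e), p (head G e)}"
    and edges_disjoint:
      "e \<in> arcs G \<Longrightarrow> f \<in> arcs G \<Longrightarrow> e \<noteq> f \<Longrightarrow>
        path_image (\<gamma> e) \<inter> path_image (\<gamma> f) \<subseteq> p ` verts G"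

section \<open>Ambient isotopy\<close>

text \<open>
  \<open>ambient_isotopy_end f\<close>: on the 3-sphere, \<open>f\<close> is the final map \<open>h\<^sub>1\<close> of an ambient isotopy,
  that is, of a continuous family \<open>h\<^sub>t\<close>, \<open>0 \<le> t \<le> 1\<close>, of self-homeomorphisms of the 3-sphere
  with \<open>h\<^sub>0 = id\<close>.
\<close>

definition ambient_isotopy_end :: "(real ^ 4 \<Rightarrow> real ^ 4) \<Rightarrow> bool" where
  "ambient_isotopy_end f \<longleftrightarrow>
     homotopic_with_canon (\<lambda>h. \<exists>k. homeomorphism S3 S3 h k) S3 S3 id f"

text \<open>
  The edges of a spatial graph are pairwise distinct subsets of the 3-sphere, so the equation on
  edges yields a color-preserving bijection between the edges of the two graphs; no relation
  between the parametrizations (in particular, the directions) of the edges is required.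
\<close>

definition ambient_isotopic_colored_graphs ::
    "('v, 'e) pre_digraph \<Rightarrow> ('v \<Rightarrow> real ^ 4) \<Rightarrow> ('e \<Rightarrow> real \<Rightarrow> real ^ 4) \<Rightarrow> ('e \<Rightarrow> 'c) \<Rightarrow>
     ('w, 'f) pre_digraph \<Rightarrow> ('w \<Rightarrow> real ^ 4) \<Rightarrow> ('f \<Rightarrow> real \<Rightarrow> real ^ 4) \<Rightarrow> ('f \<Rightarrow> 'c) \<Rightarrow> bool"
  where
  "ambient_isotopic_colored_graphs G p \<gamma> c G' p' \<gamma>' c' \<longleftrightarrow>
     (\<exists>f. ambient_isotopy_end f \<and>
        f ` p ` verts G = p' ` verts G' \<and>
        (\<lambda>e. (f ` path_image (\<gamma> e), c e)) ` arcs G =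
          (\<lambda>e. (path_image (\<gamma>' e), c' e)) ` arcs G')"

section \<open>Colored links\<close>

definition simple_closed_curve :: "(real ^ 4) set \<Rightarrow> bool" where
  "simple_closed_curve K \<longleftrightarrow>
     (\<exists>g. simple_path g \<and> pathfinish g = pathstart g \<and> path_image g = K)"

text \<open>A link whose components carry sets of colors is the set of its colored components.\<close>

type_synonym 'c link_comps = "((real ^ 4) set \<times> 'c set) set"

definition colored_link :: "'c link_comps \<Rightarrow> bool" where
  "colored_link L \<longleftrightarrow>
     finite L \<and>
     (\<forall>(K, C) \<in> L. K \<subseteq> S3 \<and> simple_closed_curve K) \<and>
     pairwise (\<lambda>x y. disjnt (fst x) (fst y)) L"

definition link_isotopy :: "('c link_comps \<times> 'c link_comps) set" where
  "link_isotopy =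
     {(L, L'). colored_link L \<and> colored_link L' \<and>
        (\<exists>f. ambient_isotopy_end f \<and> L' = (\<lambda>(K, C). (f ` K, C)) ` L)}"

section \<open>Local replacements and the collection of colored links\<close>

text \<open>
  \<open>(e, False)\<close> and \<open>(e, True)\<close> are the edge-ends of \<open>e\<close> at its tail and at its head, so a loop
  has two edge-ends at its vertex.
\<close>

definition edge_ends :: "('v, 'e) pre_digraph \<Rightarrow> 'v \<Rightarrow> ('e \<times> bool) set" where
  "edge_ends G v = {(e, b). e \<in> arcs G \<and> (if b then head G e else tail G e) = v}"

definition degree :: "('v, 'e) pre_digraph \<Rightarrow> 'v \<Rightarrow> nat" where
  "degree G v = card (edge_ends G v)"

text \<open>\<open>\<sigma> v\<close> is the set of the edge-ends at \<open>v\<close> that are connected to each other.\<close>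

definition local_replacement :: "('v, 'e) pre_digraph \<Rightarrow> ('v \<Rightarrow> ('e \<times> bool) set) \<Rightarrow> bool" where
  "local_replacement G \<sigma> \<longleftrightarrow>
     (\<forall>v \<in> verts G.
        if degree G v \<ge> 2 then \<sigma> v \<subseteq> edge_ends G v \<and> card (\<sigma> v) = 2 else \<sigma> v = {})"

text \<open>
  The two edges joined at \<open>v\<close> run all the way to the point \<open>p v\<close>, where they form an arc through
  \<open>p v\<close>.  An edge-end that stays free must come off \<open>p v\<close>; this is done by cutting off the third
  of the edge next to it.  Where exactly it is cut is irrelevant, because a curve with a free end
  is not closed and is discarded below.
\<close>

definition replaced_edge ::
    "('v, 'e) pre_digraph \<Rightarrow> ('e \<Rightarrow> real \<Rightarrow> real ^ 4) \<Rightarrow> ('v \<Rightarrow> ('e \<times> bool) set) \<Rightarrow> 'e \<Rightarrow> (real ^ 4) set"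
  where
  "replaced_edge G \<gamma> \<sigma> e =
     \<gamma> e ` {(if (e, False) \<in> \<sigma> (tail G e) then 0 else 1/3) ..
            (if (e, True) \<in> \<sigma> (head G e) then 1 else 2/3)}"

definition replaced_graph ::
    "('v, 'e) pre_digraph \<Rightarrow> ('e \<Rightarrow> real \<Rightarrow> real ^ 4) \<Rightarrow> ('v \<Rightarrow> ('e \<times> bool) set) \<Rightarrow> (real ^ 4) set"
  where
  "replaced_graph G \<gamma> \<sigma> = (\<Union>e \<in> arcs G. replaced_edge G \<gamma> \<sigma> e)"

definition replacement_link ::
    "('v, 'e) pre_digraph \<Rightarrow> ('e \<Rightarrow> real \<Rightarrow> real ^ 4) \<Rightarrow> ('e \<Rightarrow> 'c) \<Rightarrow> ('v \<Rightarrow> ('e \<times> bool) set) \<Rightarrow>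
     'c link_comps"
  where
  "replacement_link G \<gamma> c \<sigma> =
     {(K, {c e | e. e \<in> arcs G \<and> path_image (\<gamma> e) \<subseteq> K}) | K.
        K \<in> components (replaced_graph G \<gamma> \<sigma>) \<and> simple_closed_curve K}"

definition T_col ::
    "('v, 'e) pre_digraph \<Rightarrow> ('e \<Rightarrow> real \<Rightarrow> real ^ 4) \<Rightarrow> ('e \<Rightarrow> 'c) \<Rightarrow> 'c link_comps set"
  where
  "T_col G \<gamma> c = {replacement_link G \<gamma> c \<sigma> | \<sigma>. local_replacement G \<sigma>}"

text \<open>
  The elements of \<^term>\<open>T_col G \<gamma> c\<close> are colored links, so the quotient by \<^term>\<open>link_isotopy\<close>
  consists of honest (nonempty) isotopy classes.
\<close>

lemma (in spatial_graph) T_col_colored_link: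
  assumes "L \<in> T_col G \<gamma> c"
  shows "colored_link L"
proof -
  from assms obtain \<sigma> where L: "L = replacement_link G \<gamma> c \<sigma>"
    by (auto simp: T_col_def)
  let ?X = "replaced_graph G \<gamma> \<sigma>"
  have cont: "continuous_on {0..1} (\<gamma> e)" if "e \<in> arcs G" for e
    using edge_simple[OF that] by (simp add: simple_path_def path_def)
  have conn: "connected (replaced_edge G \<gamma> \<sigma> e)" if "e \<in> arcs G" for e
    unfolding replaced_edge_def
    by (intro connected_continuous_image continuous_on_subset[OF cont[OF that]]) auto
  have sub: "replaced_edge G \<gamma> \<sigma> e \<subseteq> path_image (\<gamma> e)" for e
    unfolding replaced_edge_def path_image_def by (intro image_mono) auto
  have mid: "\<gamma> e (1/2) \<in> replaced_edge G \<gamma> \<sigma> e" for e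
    unfolding replaced_edge_def by (intro imageI) auto
  have XS: "?X \<subseteq> S3"
    using sub edge_in by (fastforce simp: replaced_graph_def)
  have "components ?X \<subseteq> (\<lambda>e. connected_component_set ?X (\<gamma> e (1/2))) ` arcs G"
  proof
    fix K assume "K \<in> components ?X"
    then obtain x where x: "x \<in> ?X" "K = connected_component_set ?X x"
      by (auto simp: components_def)
    then obtain e where e: "e \<in> arcs G" "x \<in> replaced_edge G \<gamma> \<sigma> e"
      by (auto simp: replaced_graph_def)
    have "replaced_edge G \<gamma> \<sigma> e \<subseteq> ?X"
      using e(1) by (auto simp: replaced_graph_def)
    then have "\<gamma> e (1/2) \<in> connected_component_set ?X x"
      using connected_component_maximal[OF e(2) conn[OF e(1)]] mid by blast
    then have "K = connected_component_set ?X (\<gamma> e (1/2))"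
      using x(2) connected_component_eq by blast
    then show "K \<in> (\<lambda>e. connected_component_set ?X (\<gamma> e (1/2))) ` arcs G"
      using e(1) by (rule image_eqI)
  qed
  then have fin: "finite (components ?X)"
    using finite_arcs finite_surj by blast
  have "L \<subseteq> (\<lambda>K. (K, {c e | e. e \<in> arcs G \<and> path_image (\<gamma> e) \<subseteq> K})) ` components ?X"
    by (auto simp: L replacement_link_def)
  then have "finite L"
    using fin finite_surj by blast
  moreover have "\<forall>(K, C) \<in> L. K \<subseteq> S3 \<and> simple_closed_curve K"
    using subset_trans[OF in_components_subset XS] by (auto simp: L replacement_link_def)
  moreover have "pairwise (\<lambda>x y. disjnt (fst x) (fst y)) L"
  proof (rule pairwiseI)
    fix x y assume "x \<in> L" "y \<in> L" "x \<noteq> y"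
    then have "fst x \<in> components ?X" "fst y \<in> components ?X" "fst x \<noteq> fst y"
      by (auto simp: L replacement_link_def)
    then show "disjnt (fst x) (fst y)"
      unfolding disjnt_def using components_nonoverlap by blast
  qed
  ultimately show ?thesis
    by (simp add: colored_link_def)
qed

end

(*
  A simple closed curve stays connected when a point is removed, so a closed component of a
  replaced graph contains no edge with a free end.  Hence the closed components are the unions
  of sets E of full edges such that, at each vertex on the union, the joined edge-ends belong to E.
  This description does not refer to the parametrizations of the edges, so a homeomorphism of the
  3-sphere that maps one graph to the other transports it, and the local replacements with it.
*)
theory Submission
  imports Defs
begin

section \<open>Ambient isotopies\<close>

text \<open>The final homeomorphism \<open>f\<close> does not carry one replaced graph onto the
  other: free ends are cut off at parameter 1/3 or 2/3, and the parametrizations of the two graphs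
  are unrelated, even in direction. Arbitrary components of the two replaced graphs therefore cannot
  be compared. Vertices and edges can be matched, because each is determined by its position in the
  sphere; edge-ends are matched through the vertices at which they sit.\<close>

lemma ambient_isotopy_end_homeomorphism:
  assumes "ambient_isotopy_end f"
  obtains k where "homeomorphism S3 S3 f k"
  using homotopic_with_imp_property[OF assms[unfolded ambient_isotopy_end_def]] by blast

text \<open>If h_t is an isotopy from \<open>id\<close> to \<open>g\<close>, then h_t after
  \<open>f\<close> runs through homeomorphisms from \<open>f\<close> to \<open>g \<circ> f\<close>.
  Both composites and inverses of isotopy ends come from this.\<close>

lemma ambient_isotopy_end_compose_right:
  assumes "ambient_isotopy_end g" "homeomorphism S3 S3 f k"
  shows "homotopic_with_canon (\<lambda>h. \<exists>k. homeomorphism S3 S3 h k) S3 S3 f (g \<circ> f)"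
proof -
  have "homotopic_with_canon (\<lambda>h. \<exists>k. homeomorphism S3 S3 h k) S3 S3 (id \<circ> f) (g \<circ> f)"
  proof (rule homotopic_with_compose_continuous_map_right)
    show "homotopic_with_canon (\<lambda>h. \<exists>k. homeomorphism S3 S3 h k) S3 S3 id g"
      using assms(1) by (simp add: ambient_isotopy_end_def)
    show "continuous_map (top_of_set S3) (top_of_set S3) f"
      using assms(2) by (auto simp: homeomorphism_def)
    show "\<exists>k. homeomorphism S3 S3 (j \<circ> f) k" if "\<exists>k. homeomorphism S3 S3 j k" for j
      using that homeomorphism_compose[OF assms(2)] by blast
  qed
  then show ?thesis by simp
qed

lemma ambient_isotopy_end_compose:
  assumes "ambient_isotopy_end f" "ambient_isotopy_end g"
  shows "ambient_isotopy_end (g \<circ> f)"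
proof -
  obtain k where "homeomorphism S3 S3 f k"
    using assms(1) by (rule ambient_isotopy_end_homeomorphism)
  from ambient_isotopy_end_compose_right[OF assms(2) this] show ?thesis
    using assms(1) homotopic_with_trans unfolding ambient_isotopy_end_def by blast
qed

text \<open>Precomposing the isotopy from \<open>id\<close> to \<open>f\<close> with
  \<open>k\<close> gives one from \<open>k\<close> to \<open>f \<circ> k\<close>, the identity of
  the sphere; it is then run backwards.\<close>

lemma ambient_isotopy_end_inverse:
  assumes "ambient_isotopy_end f" and hk: "homeomorphism S3 S3 f k"
  shows "ambient_isotopy_end k"
proof -
  let ?P = "\<lambda>h. \<exists>k. homeomorphism S3 S3 h k"
  have kf: "homeomorphism S3 S3 k f"
    using hk by (rule homeomorphism_symD)
  have hom: "homotopic_with_canon ?P S3 S3 k (f \<circ> k)"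
    using assms(1) kf by (rule ambient_isotopy_end_compose_right)
  \<comment> \<open>\<open>f \<circ> k\<close> is known to agree with \<open>id\<close> only on the
    sphere, so the two are linked by a constant homotopy instead of a rewrite.\<close>
  have "homotopic_with_canon ?P S3 S3 (f \<circ> k) id"
  proof (rule homotopic_with_equal)
    show "?P (f \<circ> k)"
      using homotopic_with_imp_property[OF hom] by blast
    show "?P id"
      using homotopic_with_imp_property[OF assms(1)[unfolded ambient_isotopy_end_def]] by blast
    show "continuous_map (top_of_set S3) (top_of_set S3) (f \<circ> k)"
      using homotopic_with_imp_continuous_maps[OF hom] by blast
    show "(f \<circ> k) x = id x" if "x \<in> topspace (top_of_set S3)" for x
      using that hk by (simp add: homeomorphism_def)
  qed
  with hom show ?thesis
    unfolding ambient_isotopy_end_def using homotopic_with_trans homotopic_with_symD by blast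
qed

lemma sym_link_isotopy: "sym link_isotopy"
proof (rule symI)
  fix L L' :: "'c link_comps"
  assume "(L, L') \<in> link_isotopy"
  then obtain f where L: "colored_link L" "colored_link L'" and f: "ambient_isotopy_end f"
    and L': "L' = (\<lambda>(K, C). (f ` K, C)) ` L"
    by (auto simp: link_isotopy_def)
  obtain k where hk: "homeomorphism S3 S3 f k"
    using f by (rule ambient_isotopy_end_homeomorphism)
  \<comment> \<open>Components of a colored link lie in the sphere, where \<open>k\<close> undoes
    \<open>f\<close>.\<close>
  have "k ` f ` K = K" if "(K, C) \<in> L" for K C
  proof -
    have "K \<subseteq> S3"
      using L(1) that by (auto simp: colored_link_def)
    then have "k (f x) = x" if "x \<in> K" for x
      using hk that by (auto simp: homeomorphism_def)
    then show ?thesis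
      by (force simp: image_image)
  qed
  then have "(\<lambda>x. case case x of (K, C) \<Rightarrow> (f ` K, C) of (K, C) \<Rightarrow> (k ` K, C)) ` L = (\<lambda>x. x) ` L"
    by (intro image_cong refl) (simp only: split_paired_all prod.case)
  then have "L = (\<lambda>(K, C). (k ` K, C)) ` L'"
    by (simp add: L' image_image)
  with L ambient_isotopy_end_inverse[OF f hk] show "(L', L) \<in> link_isotopy"
    by (auto simp: link_isotopy_def)
qed

lemma trans_link_isotopy: "trans link_isotopy"
proof (rule transI)
  fix L L' L'' :: "'c link_comps"
  assume "(L, L') \<in> link_isotopy" "(L', L'') \<in> link_isotopy"
  then obtain f g where L: "colored_link L" "colored_link L''"
    and fg: "ambient_isotopy_end f" "ambient_isotopy_end g"
    and L'': "L'' = (\<lambda>(K, C). (g ` K, C)) ` (\<lambda>(K, C). (f ` K, C)) ` L"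
    by (auto simp: link_isotopy_def)
  have "L'' = (\<lambda>(K, C). ((g \<circ> f) ` K, C)) ` L"
    unfolding L'' image_image by (intro image_cong) (auto simp: image_image)
  with L ambient_isotopy_end_compose[OF fg] show "(L, L'') \<in> link_isotopy"
    unfolding link_isotopy_def by blast
qed

section \<open>Closed components of the replaced graph\<close>

text \<open>Shifting the parametrization makes \<open>y\<close> the base point; what remains is the
  image of the open interval.\<close>

lemma simple_closed_curve_connected_delete:
  assumes "simple_closed_curve K" "y \<in> K"
  shows "connected (K - {y})"
proof -
  obtain g where g: "simple_path g" "pathfinish g = pathstart g" "path_image g = K"
    using assms(1) by (auto simp: simple_closed_curve_def)
  then obtain a where a: "a \<in> {0..1}" "y = g a"
    using assms(2) by (auto simp: path_image_def)
  have "simple_path (shiftpath a g)"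
    using g a by (intro simple_path_shiftpath) auto
  from connected_simple_path_endless[OF this] show ?thesis
    using endpoints_shiftpath[OF g(2) a(1)] path_image_shiftpath[OF a(1) g(2)] g(3) a(2) by simp
qed

lemma simple_closed_curve_connected_closed:
  assumes "simple_closed_curve K"
  shows "connected K" "closed K" "K \<noteq> {}"
proof -
  obtain g where g: "simple_path g" "path_image g = K"
    using assms by (auto simp: simple_closed_curve_def)
  then have "path g"
    by (simp add: simple_path_imp_path)
  then show "connected K" "closed K" "K \<noteq> {}"
    using g connected_path_image closed_path_image path_image_nonempty by blast+
qed

text \<open>Otherwise deleting \<open>y\<close> would leave two nonempty, disjoint, relatively
  closed pieces of a connected set.\<close>

lemma simple_closed_curve_no_cut_point:
  assumes "simple_closed_curve (A \<union> B)" "closed A" "closed B" "A \<inter> B = {y}"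
  shows "A = {y} \<or> B = {y}"
proof (rule ccontr)
  assume nt: "\<not> (A = {y} \<or> B = {y})"
  have "connected (A \<union> B - {y})"
    using assms(1,4) by (intro simple_closed_curve_connected_delete) auto
  moreover have "A \<inter> B \<inter> (A \<union> B - {y}) = {}" "A \<union> B - {y} \<subseteq> A \<union> B"
    using assms(4) by auto
  ultimately have "A \<inter> (A \<union> B - {y}) = {} \<or> B \<inter> (A \<union> B - {y}) = {}"
    using assms(2,3) unfolding connected_closed by metis
  then show False
    using nt assms(4) by blast
qed

lemma simple_closed_curve_image:
  assumes "simple_closed_curve K" "K \<subseteq> S" "homeomorphism S T f k"
  shows "simple_closed_curve (f ` K)"
proof -
  obtain g where g: "simple_path g" "pathfinish g = pathstart g" "path_image g = K"
    using assms(1) by (auto simp: simple_closed_curve_def)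
  have "continuous_on S f" "inj_on f S"
    using assms(3) by (auto simp: homeomorphism_def intro: inj_on_inverseI)
  then have "simple_path (f \<circ> g)"
    using assms(2) g by (intro simple_path_continuous_image)
      (auto intro: continuous_on_subset inj_on_subset)
  moreover have "pathfinish (f \<circ> g) = pathstart (f \<circ> g)" "path_image (f \<circ> g) = f ` K"
    using g by (auto simp: pathfinish_compose pathstart_compose path_image_compose)
  ultimately show ?thesis
    unfolding simple_closed_curve_def by blast
qed

lemma local_replacement_subset:
  "local_replacement G \<sigma> \<Longrightarrow> v \<in> verts G \<Longrightarrow> \<sigma> v \<subseteq> edge_ends G v"
  by (auto simp: local_replacement_def split: if_splits)

section \<open>Edges, vertices and closed components of one spatial graph\<close>

context spatial_graph
begin

lemma edge_eqD:
  assumes "e \<in> arcs G" "\<gamma> e s = \<gamma> e t" "s \<in> {0..1}" "t \<in> {0..1}"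
  shows "s = t \<or> s = 0 \<and> t = 1 \<or> s = 1 \<and> t = 0"
  using edge_simple[OF assms(1)] assms(2-) by (auto simp: simple_path_def loop_free_def)

lemma edge_ends_eq:
  assumes "e \<in> arcs G"
  shows "\<gamma> e 0 = p (tail G e)" "\<gamma> e 1 = p (head G e)"
  using edge_start[OF assms] edge_finish[OF assms] by (auto simp: pathstart_def pathfinish_def)

text \<open>The vertices on an edge are its two end points, and a simple path does not return to
  them in between.\<close>

lemma edge_interior_not_vertex:
  assumes e: "e \<in> arcs G" and t: "0 < t" "t < 1"
  shows "\<gamma> e t \<notin> p ` verts G"
proof
  assume "\<gamma> e t \<in> p ` verts G"
  then have "\<gamma> e t \<in> path_image (\<gamma> e) \<inter> p ` verts G"
    using t by (auto simp: path_image_def)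
  then have "\<gamma> e t = \<gamma> e 0 \<or> \<gamma> e t = \<gamma> e 1"
    using edge_vertices[OF e] edge_ends_eq[OF e] by auto
  then show False
    using edge_eqD[OF e, of t 0] edge_eqD[OF e, of t 1] t by auto
qed

lemma edge_interior_in_edge:
  assumes "e \<in> arcs G" "e' \<in> arcs G" "0 < t" "t < 1" "\<gamma> e t \<in> path_image (\<gamma> e')"
  shows "e' = e"
proof (rule ccontr)
  assume "e' \<noteq> e"
  moreover have "\<gamma> e t \<in> path_image (\<gamma> e)"
    using assms(3,4) by (auto simp: path_image_def)
  ultimately have "\<gamma> e t \<in> p ` verts G"
    using edges_disjoint[of e e'] assms by blast
  then show False
    using edge_interior_not_vertex assms by blast
qed

text \<open>The midpoint of an edge lies on no other edge. Hence an edge can be recovered from its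
  point set, which later makes the matching of edges a bijection.\<close>

lemma inj_on_path_image_edge: "inj_on (\<lambda>e. path_image (\<gamma> e)) (arcs G)"
proof (rule inj_onI)
  fix e e' assume "e \<in> arcs G" "e' \<in> arcs G" "path_image (\<gamma> e) = path_image (\<gamma> e')"
  moreover have "\<gamma> e (1/2) \<in> path_image (\<gamma> e)"
    by (auto simp: path_image_def)
  ultimately show "e = e'"
    using edge_interior_in_edge[of e e' "1/2"] by simp
qed

lemma replaced_edge_subset: "replaced_edge G \<gamma> \<sigma> e \<subseteq> path_image (\<gamma> e)"
  unfolding replaced_edge_def path_image_def by (intro image_mono) auto

lemma compact_connected_edge_image:
  assumes "e \<in> arcs G" "{a..b} \<subseteq> {0..1}"
  shows "compact (\<gamma> e ` {a..b})" "connected (\<gamma> e ` {a..b})"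
proof -
  have "continuous_on {a..b} (\<gamma> e)"
    using edge_simple[OF assms(1)] assms(2)
    by (auto simp: simple_path_def path_def intro: continuous_on_subset)
  then show "compact (\<gamma> e ` {a..b})" "connected (\<gamma> e ` {a..b})"
    by (auto intro: compact_continuous_image connected_continuous_image)
qed

lemma compact_connected_replaced_edge:
  assumes "e \<in> arcs G"
  shows "compact (replaced_edge G \<gamma> \<sigma> e)" "connected (replaced_edge G \<gamma> \<sigma> e)"
  unfolding replaced_edge_def by (rule compact_connected_edge_image[OF assms]; auto)+

text \<open>Cutting takes the end point off exactly at a free end, and interior points are never
  vertices. A loop with a single joined end still reaches \<open>p v\<close> through that end, hence
  \<open>fst\<close> on the right-hand side.\<close>

lemma vertex_in_replaced_edge_iff:
  assumes e: "e \<in> arcs G" and v: "v \<in> verts G" and \<sigma>: "local_replacement G \<sigma>"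
  shows "p v \<in> replaced_edge G \<gamma> \<sigma> e \<longleftrightarrow> e \<in> fst ` \<sigma> v"
proof
  assume "p v \<in> replaced_edge G \<gamma> \<sigma> e"
  then obtain t where t: "p v = \<gamma> e t" "t \<in> {0..1}"
    and lo: "t = 0 \<Longrightarrow> (e, False) \<in> \<sigma> (tail G e)" and hi: "t = 1 \<Longrightarrow> (e, True) \<in> \<sigma> (head G e)"
    unfolding replaced_edge_def by (auto split: if_splits)
  have "t = 0 \<or> t = 1"
    using edge_interior_not_vertex[OF e, of t] t v by force
  then show "e \<in> fst ` \<sigma> v"
  proof
    assume "t = 0"
    with t v e have "v = tail G e"
      using edge_ends_eq[OF e] inj_onD[OF vertex_inj, of v "tail G e"] by auto
    with lo \<open>t = 0\<close> show ?thesis by force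
  next
    assume "t = 1"
    with t v e have "v = head G e"
      using edge_ends_eq[OF e] inj_onD[OF vertex_inj, of v "head G e"] by auto
    with hi \<open>t = 1\<close> show ?thesis by force
  qed
next
  assume "e \<in> fst ` \<sigma> v"
  then obtain b where b: "(e, b) \<in> \<sigma> v" by auto
  then have "(e, b) \<in> edge_ends G v"
    using local_replacement_subset[OF \<sigma> v] by blast
  then have v_eq: "v = (if b then head G e else tail G e)"
    by (auto simp: edge_ends_def)
  show "p v \<in> replaced_edge G \<gamma> \<sigma> e"
  proof (cases b)
    case True
    then show ?thesis
      using b v_eq edge_ends_eq(2)[OF e] unfolding replaced_edge_def
      by (intro image_eqI[where x = 1]) auto
  next
    case False
    then show ?thesis
      using b v_eq edge_ends_eq(1)[OF e] unfolding replaced_edge_def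
      by (intro image_eqI[where x = 0]) auto
  qed
qed

text \<open>
  This singles out the edge sets of the unions of closed curves of a local replacement without
  mentioning where the free ends are cut off, which an ambient isotopy does not preserve.
\<close>

definition closed_edge_set :: "('v \<Rightarrow> ('e \<times> bool) set) \<Rightarrow> 'e set \<Rightarrow> bool" where
  "closed_edge_set \<sigma> E \<longleftrightarrow> E \<subseteq> arcs G \<and>
     (\<forall>e\<in>E. \<forall>b. (e, b) \<in> \<sigma> (if b then head G e else tail G e)) \<and>
     (\<forall>v\<in>verts G. p v \<in> (\<Union>e\<in>E. path_image (\<gamma> e)) \<longrightarrow> fst ` \<sigma> v \<subseteq> E)"

text \<open>If the end were free, the half of \<open>e\<close> on that side would hang on the rest
  of the curve only at the midpoint of \<open>e\<close>, making the midpoint a cut point.\<close>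

lemma no_free_end:
  assumes E: "E \<subseteq> arcs G" "e \<in> E"
    and K: "simple_closed_curve (\<Union>e\<in>E. replaced_edge G \<gamma> \<sigma> e)"
  shows "(e, b) \<in> \<sigma> (if b then head G e else tail G e)"
proof (rule ccontr)
  assume free: "(e, b) \<notin> \<sigma> (if b then head G e else tail G e)"
  define lo :: real where "lo = (if (e, False) \<in> \<sigma> (tail G e) then 0 else 1/3)"
  define hi :: real where "hi = (if (e, True) \<in> \<sigma> (head G e) then 1 else 2/3)"
  have eE: "e \<in> arcs G" using E by auto
  \<comment> \<open>\<open>I\<close> parametrizes the half of \<open>e\<close> on the side of the
    free end, \<open>J\<close> the other half.\<close>
  define I where "I = (if b then {1/2..hi} else {lo..1/2})"
  define J where "J = (if b then {lo..1/2} else {1/2..hi})"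
  have lohi: "0 \<le> lo" "lo \<le> 1/3" "2/3 \<le> hi" "hi \<le> 1"
    by (auto simp: lo_def hi_def)
  \<comment> \<open>The cut at the free end keeps \<open>I\<close> away from 0 and 1, so
    \<open>\<gamma> e\<close> maps it to interior points, which lie on no other edge.\<close>
  have I: "I \<subseteq> {0<..<1}"
    using free lohi by (auto simp: I_def lo_def hi_def split: if_splits)
  have J: "J \<subseteq> {0..1}"
    using lohi by (auto simp: J_def)
  have IJ: "I \<inter> J = {1/2}" "I \<union> J = {lo..hi}"
    using lohi by (auto simp: I_def J_def)
  define A where "A = \<gamma> e ` I"
  define B where "B = \<gamma> e ` J \<union> (\<Union>e'\<in>E - {e}. replaced_edge G \<gamma> \<sigma> e')"
  have "replaced_edge G \<gamma> \<sigma> e = \<gamma> e ` (I \<union> J)"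
    by (simp add: IJ(2) replaced_edge_def lo_def hi_def)
  then have AB: "A \<union> B = (\<Union>e\<in>E. replaced_edge G \<gamma> \<sigma> e)"
    using E(2) by (auto simp: A_def B_def)
  have cl: "closed (\<gamma> e ` I)" "closed (\<gamma> e ` J)"
    using lohi unfolding I_def J_def
    by (auto intro!: compact_imp_closed compact_connected_edge_image(1)[OF eE])
  have "finite E"
    using E(1) finite_arcs finite_subset by blast
  then have "closed B"
    unfolding B_def using E(1)
    by (intro closed_Un cl closed_UN) (auto intro: compact_imp_closed compact_connected_replaced_edge)
  moreover have "A \<inter> B = {\<gamma> e (1/2)}"
  proof
    show "A \<inter> B \<subseteq> {\<gamma> e (1/2)}"
    proof
      fix x assume "x \<in> A \<inter> B"
      then obtain s where s: "x = \<gamma> e s" "s \<in> I" and xB: "x \<in> B"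
        by (auto simp: A_def)
      have s01: "0 < s" "s < 1" using I s(2) by auto
      have "x \<notin> replaced_edge G \<gamma> \<sigma> e'" if "e' \<in> E - {e}" for e'
        using edge_interior_in_edge[OF eE _ s01, of e'] replaced_edge_subset[of \<sigma> e'] that E(1) s(1)
        by auto
      then obtain t where t: "x = \<gamma> e t" "t \<in> J"
        using xB by (auto simp: B_def)
      then have "s = t"
        using edge_eqD[OF eE, of s t] s s01 J by auto
      then have "s = 1/2"
        using s(2) t(2) IJ(1) by blast
      then show "x \<in> {\<gamma> e (1/2)}"
        using s(1) by blast
    qed
    show "{\<gamma> e (1/2)} \<subseteq> A \<inter> B"
      using IJ(1) by (auto simp: A_def B_def)
  qed
  ultimately have "A = {\<gamma> e (1/2)} \<or> B = {\<gamma> e (1/2)}"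
    using K cl(1) AB by (intro simple_closed_curve_no_cut_point) (auto simp: A_def)
  moreover have "\<gamma> e (1/3) \<noteq> \<gamma> e (1/2)" "\<gamma> e (2/3) \<noteq> \<gamma> e (1/2)"
    using edge_eqD[OF eE, of "1/3" "1/2"] edge_eqD[OF eE, of "2/3" "1/2"] by auto
  \<comment> \<open>The parameters 1/3 and 2/3 survive every cut and lie in different halves, so
    neither side shrinks to the midpoint.\<close>
  moreover have "1/3 \<in> I \<and> 2/3 \<in> J \<or> 2/3 \<in> I \<and> 1/3 \<in> J"
    using lohi by (auto simp: I_def J_def)
  ultimately show False
    unfolding A_def B_def by blast
qed

text \<open>Replaced edges are connected, so a component is a union of whole replaced edges, and
  \<open>no_free_end\<close> makes these full edges. Conversely, saturation at the vertices
  separates \<open>K\<close> from all other replaced edges, and \<open>K\<close> is connected by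
  assumption.\<close>

lemma closed_component_iff:
  assumes \<sigma>: "local_replacement G \<sigma>" and K: "simple_closed_curve K"
  shows "K \<in> components (replaced_graph G \<gamma> \<sigma>) \<longleftrightarrow>
    (\<exists>E. closed_edge_set \<sigma> E \<and> K = (\<Union>e\<in>E. path_image (\<gamma> e)))"
proof
  assume comp: "K \<in> components (replaced_graph G \<gamma> \<sigma>)"
  define E where "E = {e \<in> arcs G. replaced_edge G \<gamma> \<sigma> e \<subseteq> K}"
  \<comment> \<open>A replaced edge that meets the component lies in it.\<close>
  have inE: "e \<in> E" if "e \<in> arcs G" "x \<in> K" "x \<in> replaced_edge G \<gamma> \<sigma> e" for e x
    using components_maximal[OF comp compact_connected_replaced_edge(2)[OF that(1)]] that
    by (auto simp: E_def replaced_graph_def)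
  have KE: "K = (\<Union>e\<in>E. replaced_edge G \<gamma> \<sigma> e)"
    using inE in_components_subset[OF comp] by (fastforce simp: E_def replaced_graph_def)
  have EG: "E \<subseteq> arcs G" by (auto simp: E_def)
  have full: "(e, b) \<in> \<sigma> (if b then head G e else tail G e)" if "e \<in> E" for e b
    using no_free_end[OF EG that] K KE by metis
  have "replaced_edge G \<gamma> \<sigma> e = path_image (\<gamma> e)" if "e \<in> E" for e
    using full[OF that, of False] full[OF that, of True] by (simp add: replaced_edge_def path_image_def)
  then have KE': "K = (\<Union>e\<in>E. path_image (\<gamma> e))"
    using KE by simp
  have "fst ` \<sigma> v \<subseteq> E" if v: "v \<in> verts G" "p v \<in> K" for v
  proof
    fix e assume e: "e \<in> fst ` \<sigma> v"
    then have eG: "e \<in> arcs G"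
      using local_replacement_subset[OF \<sigma> v(1)] by (auto simp: edge_ends_def)
    then show "e \<in> E"
      using inE[OF eG v(2)] vertex_in_replaced_edge_iff[OF eG v(1) \<sigma>] e by blast
  qed
  then have "closed_edge_set \<sigma> E"
    unfolding closed_edge_set_def using EG full KE' by simp
  then show "\<exists>E. closed_edge_set \<sigma> E \<and> K = (\<Union>e\<in>E. path_image (\<gamma> e))"
    using KE' by blast
next
  assume "\<exists>E. closed_edge_set \<sigma> E \<and> K = (\<Union>e\<in>E. path_image (\<gamma> e))"
  then obtain E where E: "closed_edge_set \<sigma> E" and KE: "K = (\<Union>e\<in>E. path_image (\<gamma> e))"
    by blast
  have EG: "E \<subseteq> arcs G"
    and full: "\<And>e b. e \<in> E \<Longrightarrow> (e, b) \<in> \<sigma> (if b then head G e else tail G e)"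
    and sat: "\<And>v. v \<in> verts G \<Longrightarrow> p v \<in> K \<Longrightarrow> fst ` \<sigma> v \<subseteq> E"
    using E KE unfolding closed_edge_set_def by auto
  have "replaced_edge G \<gamma> \<sigma> e = path_image (\<gamma> e)" if "e \<in> E" for e
    using full[OF that, of False] full[OF that, of True] by (simp add: replaced_edge_def path_image_def)
  then have KE': "K = (\<Union>e\<in>E. replaced_edge G \<gamma> \<sigma> e)"
    using KE by simp
  define B where "B = (\<Union>e\<in>arcs G - E. replaced_edge G \<gamma> \<sigma> e)"
  have XB: "replaced_graph G \<gamma> \<sigma> = K \<union> B"
    using EG by (auto simp: KE' B_def replaced_graph_def)
  have "closed B"
    unfolding B_def by (intro closed_UN) (auto intro: compact_imp_closed compact_connected_replaced_edge)
  \<comment> \<open>Distinct edges meet only in vertices; a replaced edge that reaches a vertex on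
    \<open>K\<close> is joined there and hence belongs to \<open>E\<close>.\<close>
  have disj: "K \<inter> B = {}"
  proof (rule equals0I)
    fix x assume "x \<in> K \<inter> B"
    then obtain e e' where e: "e \<in> E" "x \<in> path_image (\<gamma> e)"
      and e': "e' \<in> arcs G" "e' \<notin> E" "x \<in> replaced_edge G \<gamma> \<sigma> e'" and xK: "x \<in> K"
      by (auto simp: KE B_def)
    then have "x \<in> path_image (\<gamma> e) \<inter> path_image (\<gamma> e')"
      using replaced_edge_subset by blast
    then have "x \<in> p ` verts G"
      using edges_disjoint[of e e'] e(1) e'(1,2) EG by blast
    then obtain v where v: "v \<in> verts G" "x = p v" by blast
    then have "e' \<in> fst ` \<sigma> v"
      using vertex_in_replaced_edge_iff[OF e'(1) v(1) \<sigma>] e'(3) by simp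
    then show False
      using sat[OF v(1)] v(2) xK e'(2) by blast
  qed
  note Kp = simple_closed_curve_connected_closed[OF K]
  \<comment> \<open>\<open>K\<close> and \<open>B\<close> are disjoint and closed, so a connected
    set between \<open>K\<close> and their union cannot meet \<open>B\<close>.\<close>
  have "D = K" if D: "K \<subseteq> D" "D \<subseteq> K \<union> B" "connected D" for D
  proof -
    have "K \<inter> D = {} \<or> B \<inter> D = {}"
      using D(2,3) disj Kp(2) \<open>closed B\<close> unfolding connected_closed by blast
    then show ?thesis
      using D(1,2) Kp(3) by blast
  qed
  then show "K \<in> components (replaced_graph G \<gamma> \<sigma>)"
    unfolding in_components_maximal XB using Kp by blast
qed

text \<open>An edge set satisfying \<open>closed_edge_set\<close> may be empty or carry several
  curves; the condition \<open>simple_closed_curve\<close> on the union singles out the individual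
  components.\<close>

lemma closed_components_eq:
  assumes "local_replacement G \<sigma>"
  shows "{K \<in> components (replaced_graph G \<gamma> \<sigma>). simple_closed_curve K} =
    (\<lambda>E. \<Union>e\<in>E. path_image (\<gamma> e)) `
      {E. closed_edge_set \<sigma> E \<and> simple_closed_curve (\<Union>e\<in>E. path_image (\<gamma> e))}"
  using closed_component_iff[OF assms] by fastforce

end

section \<open>Transporting local replacements\<close>

locale spatial_graph_homeomorphism =
  A: spatial_graph G p \<gamma> + B: spatial_graph G' p' \<gamma>'
  for G :: "('v, 'e) pre_digraph" and p :: "'v \<Rightarrow> real ^ 4" and \<gamma> :: "'e \<Rightarrow> real \<Rightarrow> real ^ 4"
    and G' :: "('w, 'f) pre_digraph" and p' :: "'w \<Rightarrow> real ^ 4" and \<gamma>' :: "'f \<Rightarrow> real \<Rightarrow> real ^ 4" +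
  fixes f k :: "real ^ 4 \<Rightarrow> real ^ 4" and \<phi> :: "'v \<Rightarrow> 'w" and \<beta> :: "'e \<Rightarrow> 'f"
  assumes homeo: "homeomorphism S3 S3 f k"
    and \<phi>: "bij_betw \<phi> (verts G) (verts G')"
    and \<phi>_eq: "v \<in> verts G \<Longrightarrow> p' (\<phi> v) = f (p v)"
    and \<beta>: "bij_betw \<beta> (arcs G) (arcs G')"
    and \<beta>_eq: "e \<in> arcs G \<Longrightarrow> path_image (\<gamma>' (\<beta> e)) = f ` path_image (\<gamma> e)"
begin

lemma inj_f: "inj_on f S3"
  using homeo by (auto simp: homeomorphism_def intro: inj_on_inverseI)

abbreviation end_vertex :: "'e \<times> bool \<Rightarrow> 'v" where
  "end_vertex x \<equiv> (if snd x then head G (fst x) else tail G (fst x))"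

abbreviation end_vertex' :: "'f \<times> bool \<Rightarrow> 'w" where
  "end_vertex' x \<equiv> (if snd x then head G' (fst x) else tail G' (fst x))"

text \<open>
  The flag is flipped iff \<open>\<beta>\<close> reverses the direction of the edge.  The two directions of a
  loop are not distinguished: both of its ends are at the same vertex, so any matching works.
\<close>

definition end_map :: "'e \<times> bool \<Rightarrow> 'f \<times> bool" where
  "end_map x = (\<beta> (fst x), snd x = (\<phi> (tail G (fst x)) = tail G' (\<beta> (fst x))))"

lemma \<phi>_mem: "v \<in> verts G \<Longrightarrow> \<phi> v \<in> verts G'"
  using \<phi> by (auto simp: bij_betw_def)

lemma \<beta>_mem: "e \<in> arcs G \<Longrightarrow> \<beta> e \<in> arcs G'"
  using \<beta> by (auto simp: bij_betw_def)

text \<open>The end vertices of an edge are the vertices lying on it, a property of point sets that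
  the injective \<open>f\<close> respects. Only the unordered pair is obtained, as the direction may
  be reversed.\<close>

lemma endpoints_eq:
  assumes e: "e \<in> arcs G"
  shows "{tail G' (\<beta> e), head G' (\<beta> e)} = {\<phi> (tail G e), \<phi> (head G e)}"
proof -
  have V: "p' ` verts G' = f ` p ` verts G"
    using \<phi> \<phi>_eq by (force simp: bij_betw_def image_image)
  have "p' ` {tail G' (\<beta> e), head G' (\<beta> e)} = path_image (\<gamma>' (\<beta> e)) \<inter> p' ` verts G'"
    using B.edge_vertices[OF \<beta>_mem[OF e]] by simp
  also have "\<dots> = f ` (path_image (\<gamma> e) \<inter> p ` verts G)"
    unfolding V \<beta>_eq[OF e]
    using inj_on_image_Int[OF inj_f A.edge_in[OF e] A.vertex_in] by simp
  also have "\<dots> = p' ` {\<phi> (tail G e), \<phi> (head G e)}"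
    using A.edge_vertices[OF e] e by (simp add: \<phi>_eq)
  finally show ?thesis
    using e \<phi>_mem \<beta>_mem[OF e] by (subst (asm) inj_on_image_eq_iff[OF B.vertex_inj]) auto
qed

text \<open>When the tails do not correspond, \<open>endpoints_eq\<close> forces tail and head to be
  exchanged, and the flag is flipped. When they do, the heads correspond too and the flag is
  kept.\<close>

lemma end_vertex_end_map:
  assumes "fst x \<in> arcs G"
  shows "end_vertex' (end_map x) = \<phi> (end_vertex x)"
  using endpoints_eq[OF assms] by (auto simp: end_map_def doubleton_eq_iff)

lemma inj_on_end_map: "inj_on end_map (arcs G \<times> UNIV)"
  using \<beta> by (auto simp: inj_on_def end_map_def bij_betw_def)

lemma end_map_surj: "\<exists>b'. end_map (e, b') = (\<beta> e, b)"
  \<comment> \<open>For truth values, \<open>(b = r) = r\<close> is \<open>b\<close>, so applying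
    the flip to \<open>b\<close> itself gives the preimage.\<close>
  by (rule exI[of _ "b = (\<phi> (tail G e) = tail G' (\<beta> e))"]) (auto simp: end_map_def)

lemma end_map_edge_ends:
  assumes v: "v \<in> verts G"
  shows "end_map ` edge_ends G v = edge_ends G' (\<phi> v)"
proof
  show "end_map ` edge_ends G v \<subseteq> edge_ends G' (\<phi> v)"
  proof
    fix y assume "y \<in> end_map ` edge_ends G v"
    then obtain x where x: "y = end_map x" "fst x \<in> arcs G" "end_vertex x = v"
      by (force simp: edge_ends_def)
    then have "end_vertex' y = \<phi> v"
      using end_vertex_end_map by blast
    moreover have "fst y \<in> arcs G'"
      using x \<beta>_mem by (simp add: end_map_def)
    ultimately show "y \<in> edge_ends G' (\<phi> v)"
      unfolding edge_ends_def by (auto simp: case_prod_beta)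
  qed
  show "edge_ends G' (\<phi> v) \<subseteq> end_map ` edge_ends G v"
  proof
    fix y assume y: "y \<in> edge_ends G' (\<phi> v)"
    then have "fst y \<in> \<beta> ` arcs G"
      using \<beta> by (auto simp: edge_ends_def bij_betw_def)
    then obtain e where e: "e \<in> arcs G" "fst y = \<beta> e"
      by blast
    obtain b where b: "end_map (e, b) = y"
      using end_map_surj[of e "snd y"] e(2) by (metis prod.collapse)
    have "\<phi> (end_vertex (e, b)) = end_vertex' y"
      using end_vertex_end_map[of "(e, b)"] e(1) unfolding b by simp
    also have "\<dots> = \<phi> v"
      using y by (auto simp: edge_ends_def)
    finally have "end_vertex (e, b) = v"
      using \<phi> v e(1) inj_onD[of \<phi> "verts G" "end_vertex (e, b)" v] by (auto simp: bij_betw_def)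
    then have "(e, b) \<in> edge_ends G v"
      using e(1) by (cases b) (simp_all add: edge_ends_def)
    then show "y \<in> end_map ` edge_ends G v"
      using b by blast
  qed
qed

section \<open>The local replacement induced on the second graph\<close>

definition push :: "('v \<Rightarrow> ('e \<times> bool) set) \<Rightarrow> 'w \<Rightarrow> ('f \<times> bool) set" where
  "push \<sigma> w = end_map ` \<sigma> (inv_into (verts G) \<phi> w)"

lemma push_\<phi>: "v \<in> verts G \<Longrightarrow> push \<sigma> (\<phi> v) = end_map ` \<sigma> v"
  using \<phi> by (simp add: push_def bij_betw_def inv_into_f_f)

lemma edge_ends_subset: "edge_ends G v \<subseteq> arcs G \<times> UNIV"
  by (auto simp: edge_ends_def)

lemma local_replacement_subset_arcs:
  "local_replacement G \<sigma> \<Longrightarrow> v \<in> verts G \<Longrightarrow> \<sigma> v \<subseteq> arcs G \<times> UNIV"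
  using local_replacement_subset edge_ends_subset by fast

text \<open>\<open>end_map\<close> is injective and matches the edge-ends at \<open>v\<close> with
  those at \<open>\<phi> v\<close>, so degrees and the number of joined ends agree.\<close>

lemma local_replacement_push:
  assumes \<sigma>: "local_replacement G \<sigma>"
  shows "local_replacement G' (push \<sigma>)"
  unfolding local_replacement_def
proof
  fix w assume "w \<in> verts G'"
  then obtain v where v: "v \<in> verts G" "w = \<phi> v"
    using \<phi> by (auto simp: bij_betw_def)
  have "inj_on end_map (edge_ends G v)" "inj_on end_map (\<sigma> v)"
    using inj_on_end_map edge_ends_subset local_replacement_subset_arcs[OF \<sigma> v(1)]
    by (auto intro: inj_on_subset)
  then have "degree G' w = degree G v" "card (push \<sigma> w) = card (\<sigma> v)"
    using end_map_edge_ends[OF v(1)] v push_\<phi> by (auto simp: degree_def card_image dest: sym)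
  then show "if degree G' w \<ge> 2 then push \<sigma> w \<subseteq> edge_ends G' w \<and> card (push \<sigma> w) = 2
      else push \<sigma> w = {}"
    using \<sigma> v end_map_edge_ends[OF v(1)] push_\<phi>[OF v(1)]
    by (auto simp: local_replacement_def split: if_splits)
qed

lemma end_joined_iff:
  assumes \<sigma>: "local_replacement G \<sigma>" and x: "fst x \<in> arcs G"
  shows "end_map x \<in> push \<sigma> (end_vertex' (end_map x)) \<longleftrightarrow> x \<in> \<sigma> (end_vertex x)"
proof -
  have v: "end_vertex x \<in> verts G"
    using x by simp
  have "push \<sigma> (end_vertex' (end_map x)) = end_map ` \<sigma> (end_vertex x)"
    unfolding end_vertex_end_map[OF x] by (rule push_\<phi>[OF v])
  moreover have "x \<in> arcs G \<times> UNIV"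
    using x by (cases x) auto
  ultimately show ?thesis
    using inj_on_image_mem_iff[OF inj_on_end_map _ local_replacement_subset_arcs[OF \<sigma> v]] by simp
qed

text \<open>Reversing the edge exchanges its two ends, which does not affect a statement about both
  of them.\<close>

lemma edge_joined_iff:
  assumes \<sigma>: "local_replacement G \<sigma>" and e: "e \<in> arcs G"
  shows "(\<forall>b. (\<beta> e, b) \<in> push \<sigma> (if b then head G' (\<beta> e) else tail G' (\<beta> e))) \<longleftrightarrow>
    (\<forall>b. (e, b) \<in> \<sigma> (if b then head G e else tail G e))"
proof -
  let ?r = "\<phi> (tail G e) = tail G' (\<beta> e)"
  have "((e, b) \<in> \<sigma> (if b then head G e else tail G e)) \<longleftrightarrow>
      (\<beta> e, b = ?r) \<in> push \<sigma> (if b = ?r then head G' (\<beta> e) else tail G' (\<beta> e))" for b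
    using end_joined_iff[OF \<sigma>, of "(e, b)"] e unfolding end_map_def fst_conv snd_conv by blast
  from this[of False] this[of True] show ?thesis
    unfolding all_bool_eq by (cases ?r) auto
qed

lemma UN_path_image_subset: "E \<subseteq> arcs G \<Longrightarrow> (\<Union>e\<in>E. path_image (\<gamma> e)) \<subseteq> S3"
  using A.edge_in by blast

lemma UN_path_image_eq:
  "E \<subseteq> arcs G \<Longrightarrow> (\<Union>e\<in>\<beta> ` E. path_image (\<gamma>' e)) = f ` (\<Union>e\<in>E. path_image (\<gamma> e))"
  using \<beta>_eq by (auto simp: image_UN subset_iff)

text \<open>The condition at an edge concerns both ends at once, and the one at a vertex sees only
  \<open>fst\<close>; so neither depends on the flags that \<open>end_map\<close> may flip.\<close>

lemma closed_edge_set_iff: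
  assumes \<sigma>: "local_replacement G \<sigma>" and E: "E \<subseteq> arcs G"
  shows "B.closed_edge_set (push \<sigma>) (\<beta> ` E) \<longleftrightarrow> A.closed_edge_set \<sigma> E"
proof -
  let ?K = "\<Union>e\<in>E. path_image (\<gamma> e)"
  have "(p' (\<phi> v) \<in> f ` ?K \<longrightarrow> fst ` push \<sigma> (\<phi> v) \<subseteq> \<beta> ` E) \<longleftrightarrow>
      (p v \<in> ?K \<longrightarrow> fst ` \<sigma> v \<subseteq> E)" if v: "v \<in> verts G" for v
  proof -
    have "p' (\<phi> v) \<in> f ` ?K \<longleftrightarrow> p v \<in> ?K"
      unfolding \<phi>_eq[OF v]
      using inj_on_image_mem_iff[OF inj_f _ UN_path_image_subset[OF E]] A.vertex_in v by blast
    moreover have "fst ` push \<sigma> (\<phi> v) = \<beta> ` fst ` \<sigma> v"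
      by (simp add: push_\<phi>[OF v] image_image end_map_def)
    moreover have "fst ` \<sigma> v \<subseteq> arcs G"
      using local_replacement_subset_arcs[OF \<sigma> v] by auto
    ultimately show ?thesis
      using \<beta> E inj_on_image_subset_iff[of \<beta> "arcs G" "fst ` \<sigma> v" E] by (simp add: bij_betw_def)
  qed
  moreover have "verts G' = \<phi> ` verts G" "\<beta> ` E \<subseteq> arcs G'"
    using \<phi> \<beta>_mem E by (auto simp: bij_betw_def)
  moreover have "(\<forall>b. (\<beta> e, b) \<in> push \<sigma> (if b then head G' (\<beta> e) else tail G' (\<beta> e))) \<longleftrightarrow>
      (\<forall>b. (e, b) \<in> \<sigma> (if b then head G e else tail G e))" if "e \<in> E" for e
    using edge_joined_iff[OF \<sigma>] that E by blast
  ultimately show ?thesis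
    unfolding A.closed_edge_set_def B.closed_edge_set_def UN_path_image_eq[OF E]
    using E by (simp add: ball_simps)
qed

lemma closed_components_push:
  assumes \<sigma>: "local_replacement G \<sigma>"
  shows "{K \<in> components (replaced_graph G' \<gamma>' (push \<sigma>)). simple_closed_curve K} =
    (`) f ` {K \<in> components (replaced_graph G \<gamma> \<sigma>). simple_closed_curve K}"
proof -
  \<comment> \<open>Both directions are needed to match the edge sets exactly; the forward one
    applies the inverse \<open>k\<close>.\<close>
  have scc: "simple_closed_curve (f ` K) \<longleftrightarrow> simple_closed_curve K" if K: "K \<subseteq> S3" for K
  proof
    assume "simple_closed_curve (f ` K)"
    moreover have "f ` K \<subseteq> S3" "k ` f ` K = K"
      using homeo K by (force simp: homeomorphism_def image_image subset_iff)+
    ultimately show "simple_closed_curve K"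
      using simple_closed_curve_image[OF _ _ homeomorphism_symD[OF homeo], of "f ` K"] by simp
  qed (rule simple_closed_curve_image[OF _ K homeo])
  have "{E. B.closed_edge_set (push \<sigma>) E \<and> simple_closed_curve (\<Union>e\<in>E. path_image (\<gamma>' e))} =
    (`) \<beta> ` {E. A.closed_edge_set \<sigma> E \<and> simple_closed_curve (\<Union>e\<in>E. path_image (\<gamma> e))}"
    (is "?X' = _ ` ?X")
  proof -
    have iff: "\<beta> ` E \<in> ?X' \<longleftrightarrow> E \<in> ?X" if E: "E \<subseteq> arcs G" for E
      unfolding mem_Collect_eq closed_edge_set_iff[OF \<sigma> E] UN_path_image_eq[OF E]
        scc[OF UN_path_image_subset[OF E]] by (rule refl)
    have X: "E \<subseteq> arcs G" if "E \<in> ?X" for E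
      using that by (simp add: A.closed_edge_set_def)
    \<comment> \<open>As \<open>\<beta>\<close> is onto, every edge set of the second graph is the
      image of one of the first.\<close>
    have X': "\<exists>E\<subseteq>arcs G. E' = \<beta> ` E" if "E' \<in> ?X'" for E'
    proof -
      have "E' \<subseteq> \<beta> ` arcs G"
        using that \<beta> by (simp add: B.closed_edge_set_def bij_betw_def)
      then show ?thesis
        unfolding subset_image_iff by blast
    qed
    show ?thesis
    proof
      show "?X' \<subseteq> (`) \<beta> ` ?X"
      proof
        fix E' assume E': "E' \<in> ?X'"
        then obtain E where "E \<subseteq> arcs G" "E' = \<beta> ` E"
          using X' by blast
        with E' iff show "E' \<in> (`) \<beta> ` ?X" by blast
      qed
      show "(`) \<beta> ` ?X \<subseteq> ?X'"
        using X iff by blast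
    qed
  qed
  moreover have "(\<lambda>E. \<Union>e\<in>\<beta> ` E. path_image (\<gamma>' e)) ` ?X = (\<lambda>E. f ` (\<Union>e\<in>E. path_image (\<gamma> e))) ` ?X"
    by (intro image_cong refl UN_path_image_eq) (simp add: A.closed_edge_set_def)
  ultimately show ?thesis
    unfolding A.closed_components_eq[OF \<sigma>] B.closed_components_eq[OF local_replacement_push[OF \<sigma>]]
    by (simp only: image_image[of "\<lambda>E. \<Union>e\<in>E. path_image (\<gamma>' e)"] image_image[of "(`) f"])
qed

text \<open>The color set of a component depends only on which full edges it contains, and
  \<open>\<beta>\<close> matches these edges together with their colors.\<close>

lemma replacement_link_push:
  assumes \<sigma>: "local_replacement G \<sigma>" and c: "\<And>e. e \<in> arcs G \<Longrightarrow> c' (\<beta> e) = c e"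
  shows "replacement_link G' \<gamma>' c' (push \<sigma>) = (\<lambda>(K, C). (f ` K, C)) ` replacement_link G \<gamma> c \<sigma>"
proof -
  let ?col = "\<lambda>K. {c e | e. e \<in> arcs G \<and> path_image (\<gamma> e) \<subseteq> K}"
  let ?col' = "\<lambda>K. {c' e | e. e \<in> arcs G' \<and> path_image (\<gamma>' e) \<subseteq> K}"
  let ?S = "{K \<in> components (replaced_graph G \<gamma> \<sigma>). simple_closed_curve K}"
  let ?S' = "{K \<in> components (replaced_graph G' \<gamma>' (push \<sigma>)). simple_closed_curve K}"
  have sub: "replaced_graph G \<gamma> \<sigma> \<subseteq> S3"
    using A.replaced_edge_subset A.edge_in unfolding replaced_graph_def by blast
  have col: "?col' (f ` K) = ?col K" if K: "K \<in> ?S" for K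
  proof -
    have KS: "K \<subseteq> S3"
      using K in_components_subset sub by blast
    have "path_image (\<gamma>' (\<beta> e)) \<subseteq> f ` K \<longleftrightarrow> path_image (\<gamma> e) \<subseteq> K" if "e \<in> arcs G" for e
      unfolding \<beta>_eq[OF that]
      using inj_on_image_subset_iff[OF inj_f A.edge_in[OF that] KS] .
    moreover have "arcs G' = \<beta> ` arcs G"
      using \<beta> by (simp add: bij_betw_def)
    ultimately show ?thesis
      using c by auto (metis (no_types, lifting) imageI)+
  qed
  have "replacement_link G' \<gamma>' c' (push \<sigma>) = (\<lambda>K. (K, ?col' K)) ` ?S'"
    unfolding replacement_link_def by blast
  also have "\<dots> = (\<lambda>K. (f ` K, ?col' (f ` K))) ` ?S"
    unfolding closed_components_push[OF \<sigma>] image_image by (rule refl)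
  also have "\<dots> = (\<lambda>K. (f ` K, ?col K)) ` ?S"
    using col by (intro image_cong) simp_all
  also have "\<dots> = (\<lambda>(K, C). (f ` K, C)) ` (\<lambda>K. (K, ?col K)) ` ?S"
    unfolding image_image by simp
  also have "(\<lambda>K. (K, ?col K)) ` ?S = replacement_link G \<gamma> c \<sigma>"
    unfolding replacement_link_def by blast
  finally show ?thesis .
qed

end

section \<open>From isotopic graphs to equal sets of link classes\<close>

text \<open>Applying \<open>k\<close> to both set equations cancels \<open>f\<close>, because
  vertices and edges lie in the sphere.\<close>

lemma ambient_isotopic_colored_graphs_sym:
  assumes G: "spatial_graph G p \<gamma>"
    and iso: "ambient_isotopic_colored_graphs G p \<gamma> c G' p' \<gamma>' c'"
  shows "ambient_isotopic_colored_graphs G' p' \<gamma>' c' G p \<gamma> c"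
proof -
  interpret spatial_graph G p \<gamma> by (rule G)
  obtain f where f: "ambient_isotopy_end f" and V: "f ` p ` verts G = p' ` verts G'"
    and E: "(\<lambda>e. (f ` path_image (\<gamma> e), c e)) ` arcs G = (\<lambda>e. (path_image (\<gamma>' e), c' e)) ` arcs G'"
    using iso by (auto simp: ambient_isotopic_colored_graphs_def)
  obtain k where hk: "homeomorphism S3 S3 f k"
    using f by (rule ambient_isotopy_end_homeomorphism)
  have kf: "k ` f ` K = K" if "K \<subseteq> S3" for K
  proof -
    have "k (f x) = x" if "x \<in> K" for x
      using hk that \<open>K \<subseteq> S3\<close> by (auto simp: homeomorphism_def)
    then show ?thesis
      by (force simp: image_image)
  qed
  have "k ` p' ` verts G' = p ` verts G"
    using kf[OF vertex_in] V by simp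
  moreover have "(\<lambda>e. (k ` path_image (\<gamma>' e), c' e)) ` arcs G' =
      (\<lambda>(K, C). (k ` K, C)) ` (\<lambda>e. (path_image (\<gamma>' e), c' e)) ` arcs G'"
    by (simp add: image_image)
  then have "(\<lambda>e. (k ` path_image (\<gamma>' e), c' e)) ` arcs G' = (\<lambda>e. (path_image (\<gamma> e), c e)) ` arcs G"
    unfolding E[symmetric] by (subst (asm) image_image) (simp only: prod.case kf[OF edge_in] cong: image_cong)
  ultimately show ?thesis
    unfolding ambient_isotopic_colored_graphs_def
    using ambient_isotopy_end_inverse[OF f hk] by blast
qed

lemma T_col_isotopic_link:
  assumes G: "spatial_graph G p \<gamma>" and G': "spatial_graph G' p' \<gamma>'"
    and iso: "ambient_isotopic_colored_graphs G p \<gamma> c G' p' \<gamma>' c'"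
    and L: "L \<in> T_col G \<gamma> c"
  shows "\<exists>L'\<in>T_col G' \<gamma>' c'. (L, L') \<in> link_isotopy"
proof -
  interpret A: spatial_graph G p \<gamma> by (rule G)
  interpret B: spatial_graph G' p' \<gamma>' by (rule G')
  obtain f where f: "ambient_isotopy_end f" and V: "f ` p ` verts G = p' ` verts G'"
    and E: "(\<lambda>e. (f ` path_image (\<gamma> e), c e)) ` arcs G = (\<lambda>e. (path_image (\<gamma>' e), c' e)) ` arcs G'"
    using iso by (auto simp: ambient_isotopic_colored_graphs_def)
  obtain k where hk: "homeomorphism S3 S3 f k"
    using f by (rule ambient_isotopy_end_homeomorphism)
  have inj: "inj_on f S3"
    using hk by (auto simp: homeomorphism_def intro: inj_on_inverseI)
  \<comment> \<open>\<open>\<phi> v\<close> is the only vertex of the second graph placed at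
    \<open>f (p v)\<close>.\<close>
  define \<phi> where "\<phi> = inv_into (verts G') p' \<circ> (f \<circ> p)"
  have "inj_on (f \<circ> p) (verts G)"
    using A.vertex_inj inj A.vertex_in by (blast intro: comp_inj_on inj_on_subset)
  then have "bij_betw (f \<circ> p) (verts G) (p' ` verts G')"
    using V by (auto simp: bij_betw_def image_comp)
  then have \<phi>: "bij_betw \<phi> (verts G) (verts G')"
    unfolding \<phi>_def
    by (rule bij_betw_trans[OF _ bij_betw_inv_into[OF inj_on_imp_bij_betw[OF B.vertex_inj]]])
  have \<phi>_eq: "p' (\<phi> v) = f (p v)" if "v \<in> verts G" for v
    using that V unfolding \<phi>_def comp_def by (intro f_inv_into_f) blast
  \<comment> \<open>Point set and color are equated as a pair, so one choice of \<open>e'\<close>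
    serves both.\<close>
  have "\<forall>e\<in>arcs G. \<exists>e'\<in>arcs G'. path_image (\<gamma>' e') = f ` path_image (\<gamma> e) \<and> c' e' = c e"
  proof
    fix e assume "e \<in> arcs G"
    then have "(f ` path_image (\<gamma> e), c e) \<in> (\<lambda>e. (path_image (\<gamma>' e), c' e)) ` arcs G'"
      unfolding E[symmetric] by blast
    then show "\<exists>e'\<in>arcs G'. path_image (\<gamma>' e') = f ` path_image (\<gamma> e) \<and> c' e' = c e"
      by auto
  qed
  then obtain \<beta> where \<beta>: "\<And>e. e \<in> arcs G \<Longrightarrow> \<beta> e \<in> arcs G'"
    "\<And>e. e \<in> arcs G \<Longrightarrow> path_image (\<gamma>' (\<beta> e)) = f ` path_image (\<gamma> e)"
    "\<And>e. e \<in> arcs G \<Longrightarrow> c' (\<beta> e) = c e"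
    by metis
  \<comment> \<open>Injectivity and surjectivity both rest on edges being determined by their point
    sets.\<close>
  have "bij_betw \<beta> (arcs G) (arcs G')"
  proof (rule bij_betwI')
    fix e e' assume e: "e \<in> arcs G" "e' \<in> arcs G"
    have "e = e'" if "\<beta> e = \<beta> e'"
    proof -
      have "f ` path_image (\<gamma> e) = f ` path_image (\<gamma> e')"
        using \<beta>(2)[OF e(1)] \<beta>(2)[OF e(2)] that by simp
      then have "path_image (\<gamma> e) = path_image (\<gamma> e')"
        using inj_on_image_eq_iff[OF inj] A.edge_in e by blast
      then show ?thesis
        using inj_onD[OF A.inj_on_path_image_edge] e by blast
    qed
    then show "\<beta> e = \<beta> e' \<longleftrightarrow> e = e'" by blast
  next
    fix e' assume e': "e' \<in> arcs G'"
    then have "(path_image (\<gamma>' e'), c' e') \<in> (\<lambda>e. (f ` path_image (\<gamma> e), c e)) ` arcs G"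
      unfolding E by blast
    then obtain e where e: "e \<in> arcs G" "path_image (\<gamma>' e') = f ` path_image (\<gamma> e)"
      by auto
    then have "e' = \<beta> e"
      using inj_onD[OF B.inj_on_path_image_edge] e' \<beta>(1,2) by simp
    then show "\<exists>e\<in>arcs G. e' = \<beta> e"
      using e(1) by blast
  qed (rule \<beta>(1))
  then interpret H: spatial_graph_homeomorphism G p \<gamma> G' p' \<gamma>' f k \<phi> \<beta>
    by unfold_locales (use hk \<phi> \<phi>_eq \<beta>(2) in auto)
  obtain \<sigma> where \<sigma>: "local_replacement G \<sigma>" "L = replacement_link G \<gamma> c \<sigma>"
    using L by (auto simp: T_col_def)
  define L' where "L' = replacement_link G' \<gamma>' c' (H.push \<sigma>)"
  have L': "L' \<in> T_col G' \<gamma>' c'"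
    using H.local_replacement_push[OF \<sigma>(1)] by (auto simp: L'_def T_col_def)
  moreover have "L' = (\<lambda>(K, C). (f ` K, C)) ` L"
    unfolding L'_def \<sigma>(2) using \<sigma>(1) \<beta>(3) by (rule H.replacement_link_push)
  then have "(L, L') \<in> link_isotopy"
    using A.T_col_colored_link[OF L] B.T_col_colored_link[OF L'] f
    by (auto simp: link_isotopy_def)
  ultimately show ?thesis by blast
qed

text \<open>Symmetry and transitivity already give related elements the same class. This suits
  \<open>link_isotopy\<close>, which relates only colored links and so is not reflexive on its whole
  type.\<close>

lemma quotient_subset:
  assumes "sym r" "trans r" "\<And>x. x \<in> S \<Longrightarrow> \<exists>y\<in>T. (x, y) \<in> r"
  shows "S // r \<subseteq> T // r"
proof
  fix X assume "X \<in> S // r"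
  then obtain x where x: "x \<in> S" "X = r `` {x}"
    by (auto simp: quotient_def)
  then obtain y where y: "y \<in> T" "(x, y) \<in> r"
    using assms(3) by blast
  then have "r `` {x} = r `` {y}"
    using symD[OF assms(1)] transD[OF assms(2)] by blast
  then show "X \<in> T // r"
    using x y by (auto simp: quotient_def)
qed

theorem theorem6:
  fixes G :: "('v, 'e) pre_digraph" and p :: "'v \<Rightarrow> real ^ 4"
    and \<gamma> :: "'e \<Rightarrow> real \<Rightarrow> real ^ 4" and c :: "'e \<Rightarrow> 'c"
    and G' :: "('w, 'f) pre_digraph" and p' :: "'w \<Rightarrow> real ^ 4"
    and \<gamma>' :: "'f \<Rightarrow> real \<Rightarrow> real ^ 4" and c' :: "'f \<Rightarrow> 'c"
  assumes "spatial_graph G p \<gamma>" and "spatial_graph G' p' \<gamma>'"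
    and "ambient_isotopic_colored_graphs G p \<gamma> c G' p' \<gamma>' c'"
  shows "T_col G \<gamma> c // link_isotopy = T_col G' \<gamma>' c' // link_isotopy"
proof
  show "T_col G \<gamma> c // link_isotopy \<subseteq> T_col G' \<gamma>' c' // link_isotopy"
    by (intro quotient_subset sym_link_isotopy trans_link_isotopy T_col_isotopic_link[OF assms])
  \<comment> \<open>The reverse inclusion uses the inverse isotopy, which spares a proof that every
    replacement of the second graph arises by \<open>push\<close>.\<close>
  show "T_col G' \<gamma>' c' // link_isotopy \<subseteq> T_col G \<gamma> c // link_isotopy"
    by (intro quotient_subset sym_link_isotopy trans_link_isotopy
        T_col_isotopic_link[OF assms(2,1) ambient_isotopic_colored_graphs_sym[OF assms(1,3)]])
qed

end
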